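(* Let $R$ be a commutative ring with identity and let $K$ be a finite abstract simplicial complex with face relation $\leq$. Let $\operatorname{Spec}(R)$ denote the set of prime ideals of $R$, and view $(\operatorname{Spec}(R),\subseteq)$ as a poset category. Let $\mathcal{P}:(K,\leq)^{\mathrm{op}}\rightarrow(\operatorname{Spec}(R),\subseteq)$ be any functor, $\sigma\mapsto\mathcal{P}_\sigma$. Set $\mathcal{O}_\sigma=R_{\mathcal{P}_\sigma}$ (the localization of $R$ at the prime ideal $\mathcal{P}_\sigma$) for each $\sigma\in K$, and for $\sigma\leq\tau$ in $K$ let $\mathcal{O}_{\sigma,\tau}:R_{\mathcal{P}_\sigma}\rightarrow R_{\mathcal{P}_\tau}$ be the canonical ring homomorphism $r/s\mapsto r/s$ (for $r\in R$, $s\in R\setminus\mathcal{P}_\sigma$). Then these data are well defined and form a cellular sheaf of rings $\mathcal{O}:(K,\leq)\rightarrow\mathsf{Ring}$ on $K$.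
   Context: A simplicial complex $K$ on a finite vertex set $V=\{1,\dots,n\}$ is a collection of non-empty subsets of $V$ (simplices), containing every singleton, such that every non-empty subset of a member of $K$ is again in $K$. The face relation is $\sigma\leq\tau$ iff $\sigma\subseteq\tau$, so $(K,\leq)$ is a poset, regarded as a category with one morphism $\sigma\to\tau$ whenever $\sigma\leq\tau$; $(K,\leq)^{\mathrm{op}}$ is the opposite category. $\mathsf{Ring}$ is the category of commutative rings with identity and identity-preserving ring homomorphisms. A cellular sheaf of rings on $K$ is a covariant functor $\mathcal{O}:(K,\leq)\to\mathsf{Ring}$: it assigns to each $\sigma\in K$ a ring $\mathcal{O}_\sigma$ and to each face relation $\sigma\leq\tau$ a ring homomorphism $\mathcal{O}_{\sigma,\tau}:\mathcal{O}_\sigma\to\mathcal{O}_\tau$, with $\mathcal{O}_{\sigma,\sigma}=\mathrm{id}$ and $\mathcal{O}_{\tau,\rho}\circ\mathcal{O}_{\sigma,\tau}=\mathcal{O}_{\sigma,\rho}$ whenever $\sigma\leq\tau\leq\rho$. A functor $(K,\leq)^{\mathrm{op}}\to(\operatorname{Spec}(R),\subseteq)$ is the same as an order-reversing map, i.e. $\mathcal{P}_\tau\subseteq\mathcal{P}_\sigma$ whenever $\sigma\leq\tau$. For a prime ideal $\mathfrak{p}$ of $R$, $R_{\mathfrak{p}}$ is the ring of fractions $r/s$ with $r\in R$ and $s\in R\setminus\mathfrak{p}$. *)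

theory Defs
  imports "HOL-Algebra.RingHom"
begin

locale simplicial_complex =
  fixes V :: "'v set" and K :: "'v set set"
  assumes finite_vertices: "finite V"
    and simplex_subset: "\<And>\<sigma>. \<sigma> \<in> K \<Longrightarrow> \<sigma> \<subseteq> V"
    and simplex_nonempty: "\<And>\<sigma>. \<sigma> \<in> K \<Longrightarrow> \<sigma> \<noteq> {}"
    and vertex_simplex: "\<And>v. v \<in> V \<Longrightarrow> {v} \<in> K"
    and face_closed: "\<And>\<sigma> \<tau>. \<tau> \<in> K \<Longrightarrow> \<sigma> \<subseteq> \<tau> \<Longrightarrow> \<sigma> \<noteq> {} \<Longrightarrow> \<sigma> \<in> K"

(* HOL functions are total, so the functor laws are imposed on simplices of K and on
   elements of the carriers only; the values of \<O> and res elsewhere are irrelevant. *)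
locale cellular_sheaf_of_rings = simplicial_complex V K
  for V :: "'v set" and K :: "'v set set" +
  fixes \<O> :: "'v set \<Rightarrow> ('b, 'm) ring_scheme"
    and res :: "'v set \<Rightarrow> 'v set \<Rightarrow> 'b \<Rightarrow> 'b"
  assumes stalk_cring: "\<And>\<sigma>. \<sigma> \<in> K \<Longrightarrow> cring (\<O> \<sigma>)"
    and res_hom: "\<And>\<sigma> \<tau>. \<sigma> \<in> K \<Longrightarrow> \<tau> \<in> K \<Longrightarrow> \<sigma> \<subseteq> \<tau> \<Longrightarrow> res \<sigma> \<tau> \<in> ring_hom (\<O> \<sigma>) (\<O> \<tau>)"
    and res_id: "\<And>\<sigma> x. \<sigma> \<in> K \<Longrightarrow> x \<in> carrier (\<O> \<sigma>) \<Longrightarrow> res \<sigma> \<sigma> x = x"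
    and res_comp: "\<And>\<sigma> \<tau> \<rho> x. \<sigma> \<in> K \<Longrightarrow> \<tau> \<in> K \<Longrightarrow> \<rho> \<in> K \<Longrightarrow> \<sigma> \<subseteq> \<tau> \<Longrightarrow> \<tau> \<subseteq> \<rho> \<Longrightarrow>
      x \<in> carrier (\<O> \<sigma>) \<Longrightarrow> res \<tau> \<rho> (res \<sigma> \<tau> x) = res \<sigma> \<rho> x"

definition Spec :: "('a, 'm) ring_scheme \<Rightarrow> 'a set set" where
  "Spec R = {\<pp>. primeideal \<pp> R}"

definition frac_rel :: "('a, 'm) ring_scheme \<Rightarrow> 'a set \<Rightarrow> (('a \<times> 'a) \<times> ('a \<times> 'a)) set" where
  "frac_rel R S = {((r, s), (r', s')). r \<in> carrier R \<and> s \<in> S \<and> r' \<in> carrier R \<and> s' \<in> S \<and>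
     (\<exists>u\<in>S. u \<otimes>\<^bsub>R\<^esub> (r \<otimes>\<^bsub>R\<^esub> s' \<ominus>\<^bsub>R\<^esub> r' \<otimes>\<^bsub>R\<^esub> s) = \<zero>\<^bsub>R\<^esub>)}"

(* The fraction r/s; this is the empty set when s is not an admissible denominator. *)
definition frac_class :: "('a, 'm) ring_scheme \<Rightarrow> 'a set \<Rightarrow> 'a \<Rightarrow> 'a \<Rightarrow> ('a \<times> 'a) set" where
  "frac_class R S r s = frac_rel R S `` {(r, s)}"

(* The unions run over all representatives; when the result does not depend on the
   representatives, as proved below, they collapse to a single fraction. *)
definition localization :: "('a, 'm) ring_scheme \<Rightarrow> 'a set \<Rightarrow> ('a \<times> 'a) set ring" where
  "localization R S = \<lparr>
     carrier = (carrier R \<times> S) // frac_rel R S,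
     mult = (\<lambda>A B. \<Union>(r, s)\<in>A. \<Union>(r', s')\<in>B.
       frac_class R S (r \<otimes>\<^bsub>R\<^esub> r') (s \<otimes>\<^bsub>R\<^esub> s')),
     one = frac_class R S \<one>\<^bsub>R\<^esub> \<one>\<^bsub>R\<^esub>,
     zero = frac_class R S \<zero>\<^bsub>R\<^esub> \<one>\<^bsub>R\<^esub>,
     add = (\<lambda>A B. \<Union>(r, s)\<in>A. \<Union>(r', s')\<in>B.
       frac_class R S (r \<otimes>\<^bsub>R\<^esub> s' \<oplus>\<^bsub>R\<^esub> r' \<otimes>\<^bsub>R\<^esub> s) (s \<otimes>\<^bsub>R\<^esub> s'))\<rparr>"

definition frac_at :: "('a, 'm) ring_scheme \<Rightarrow> 'a set \<Rightarrow> 'a \<Rightarrow> 'a \<Rightarrow> ('a \<times> 'a) set" where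
  "frac_at R \<pp> = frac_class R (carrier R - \<pp>)"

definition localization_at :: "('a, 'm) ring_scheme \<Rightarrow> 'a set \<Rightarrow> ('a \<times> 'a) set ring" where
  "localization_at R \<pp> = localization R (carrier R - \<pp>)"

(* The assignment sending r/s in the localization at \<pp> to r/s in the localization at \<qq>,
   again as a union over all representatives r/s; only the target prime enters. *)
definition localization_map :: "('a, 'm) ring_scheme \<Rightarrow> 'a set \<Rightarrow> ('a \<times> 'a) set \<Rightarrow> ('a \<times> 'a) set" where
  "localization_map R \<qq> A = (\<Union>(r, s)\<in>A. frac_at R \<qq> r s)"

locale mult_closed_subset = cring R for R (structure) +
  fixes S
  assumes S_subset: "S \<subseteq> carrier R"
    and one_mem: "\<one> \<in> S"
    and mult_mem: "\<And>s t. s \<in> S \<Longrightarrow> t \<in> S \<Longrightarrow> s \<otimes> t \<in> S"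
begin

lemma S_carrier: "s \<in> S \<Longrightarrow> s \<in> carrier R"
  using S_subset by blast

lemma frac_rel_iff:
  "((r, s), (r', s')) \<in> frac_rel R S \<longleftrightarrow> r \<in> carrier R \<and> s \<in> S \<and> r' \<in> carrier R \<and> s' \<in> S \<and>
     (\<exists>u\<in>S. u \<otimes> (r \<otimes> s') = u \<otimes> (r' \<otimes> s))"
proof -
  have "u \<otimes> (r \<otimes> s' \<ominus> r' \<otimes> s) = \<zero> \<longleftrightarrow> u \<otimes> (r \<otimes> s') = u \<otimes> (r' \<otimes> s)"
    if "u \<in> carrier R" "r \<in> carrier R" "s \<in> carrier R" "r' \<in> carrier R" "s' \<in> carrier R"
    for u
  proof -
    have "u \<otimes> (r \<otimes> s' \<ominus> r' \<otimes> s) = u \<otimes> (r \<otimes> s') \<ominus> u \<otimes> (r' \<otimes> s)"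
      using that by (simp add: a_minus_def r_distr r_minus)
    moreover have "x \<ominus> y = \<zero> \<longleftrightarrow> x = y" if "x \<in> carrier R" "y \<in> carrier R" for x y
      using that by (metis a_minus_def add.inv_closed minus_equality minus_minus r_neg)
    ultimately show ?thesis using that by simp
  qed
  then show ?thesis
    unfolding frac_rel_def using S_carrier by auto
qed

lemma equiv_frac_rel: "equiv (carrier R \<times> S) (frac_rel R S)"
proof (rule equivI)
  show "frac_rel R S \<subseteq> (carrier R \<times> S) \<times> (carrier R \<times> S)"
    by (auto simp: frac_rel_iff)
  show "refl_on (carrier R \<times> S) (frac_rel R S)"
    using one_mem by (auto simp: refl_on_def frac_rel_iff)
  show "sym (frac_rel R S)"
    by (auto simp: sym_def frac_rel_iff) metis
  show "trans (frac_rel R S)"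
  proof (rule transI, clarify)
    fix a s b t c w
    assume "((a, s), (b, t)) \<in> frac_rel R S" "((b, t), (c, w)) \<in> frac_rel R S"
    then obtain u v where m: "a \<in> carrier R" "b \<in> carrier R" "c \<in> carrier R"
      "s \<in> S" "t \<in> S" "w \<in> S" "u \<in> S" "v \<in> S"
      and u: "u \<otimes> (a \<otimes> t) = u \<otimes> (b \<otimes> s)" and v: "v \<otimes> (b \<otimes> w) = v \<otimes> (c \<otimes> t)"
      by (auto simp: frac_rel_iff)
    note c = m(1-3) m(4-8)[THEN S_carrier]
    have "(t \<otimes> (u \<otimes> v)) \<otimes> (a \<otimes> w) = (u \<otimes> (a \<otimes> t)) \<otimes> (v \<otimes> w)" using c by (simp add: m_ac)
    also have "\<dots> = (v \<otimes> (b \<otimes> w)) \<otimes> (u \<otimes> s)" unfolding u using c by (simp add: m_ac)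
    also have "\<dots> = (t \<otimes> (u \<otimes> v)) \<otimes> (c \<otimes> s)" unfolding v using c by (simp add: m_ac)
    finally show "((a, s), (c, w)) \<in> frac_rel R S"
      using m mult_mem by (auto simp: frac_rel_iff)
  qed
qed

lemma frac_class_eq_iff:
  assumes "r \<in> carrier R" "s \<in> S" "r' \<in> carrier R" "s' \<in> S"
  shows "frac_class R S r s = frac_class R S r' s' \<longleftrightarrow> (\<exists>u\<in>S. u \<otimes> (r \<otimes> s') = u \<otimes> (r' \<otimes> s))"
  unfolding frac_class_def using assms
  by (subst eq_equiv_class_iff[OF equiv_frac_rel]) (auto simp: frac_rel_iff)

lemma localization_mult_frac:
  assumes "r \<in> carrier R" "s \<in> S" "r' \<in> carrier R" "s' \<in> S"
  shows "frac_class R S r s \<otimes>\<^bsub>localization R S\<^esub> frac_class R S r' s'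
    = frac_class R S (r \<otimes> r') (s \<otimes> s')"
proof -
  let ?f = "\<lambda>(r, s) (r', s'). frac_class R S (r \<otimes> r') (s \<otimes> s')"
  have "congruent2 (frac_rel R S) (frac_rel R S) ?f"
  proof (rule congruent2I', clarify)
    fix a s b t a' s' b' t'
    assume "((a, s), (b, t)) \<in> frac_rel R S" "((a', s'), (b', t')) \<in> frac_rel R S"
    then obtain u v where m: "a \<in> carrier R" "b \<in> carrier R" "a' \<in> carrier R" "b' \<in> carrier R"
      "s \<in> S" "t \<in> S" "s' \<in> S" "t' \<in> S" "u \<in> S" "v \<in> S"
      and u: "u \<otimes> (a \<otimes> t) = u \<otimes> (b \<otimes> s)" and v: "v \<otimes> (a' \<otimes> t') = v \<otimes> (b' \<otimes> s')"
      by (auto simp: frac_rel_iff)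
    note c = m(1-4) m(5-10)[THEN S_carrier]
    have "(u \<otimes> v) \<otimes> ((a \<otimes> a') \<otimes> (t \<otimes> t')) = (u \<otimes> (a \<otimes> t)) \<otimes> (v \<otimes> (a' \<otimes> t'))"
      using c by (simp add: m_ac)
    also have "\<dots> = (u \<otimes> v) \<otimes> ((b \<otimes> b') \<otimes> (s \<otimes> s'))"
      unfolding u v using c by (simp add: m_ac)
    finally show "frac_class R S (a \<otimes> a') (s \<otimes> s') = frac_class R S (b \<otimes> b') (t \<otimes> t')"
      using m mult_mem by (subst frac_class_eq_iff) auto
  qed
  from UN_equiv_class2[OF equiv_frac_rel equiv_frac_rel this] 
  have "(\<Union>x\<in>frac_rel R S `` {(r, s)}. \<Union>y\<in>frac_rel R S `` {(r', s')}. ?f x y) = ?f (r, s) (r', s')"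
    using assms by blast
  then show ?thesis
    by (simp add: localization_def frac_class_def case_prod_beta')
qed

lemma localization_add_frac:
  assumes "r \<in> carrier R" "s \<in> S" "r' \<in> carrier R" "s' \<in> S"
  shows "frac_class R S r s \<oplus>\<^bsub>localization R S\<^esub> frac_class R S r' s'
    = frac_class R S (r \<otimes> s' \<oplus> r' \<otimes> s) (s \<otimes> s')"
proof -
  let ?f = "\<lambda>(r, s) (r', s'). frac_class R S (r \<otimes> s' \<oplus> r' \<otimes> s) (s \<otimes> s')"
  have "congruent2 (frac_rel R S) (frac_rel R S) ?f"
  proof (rule congruent2I', clarify)
    fix a s b t a' s' b' t'
    assume "((a, s), (b, t)) \<in> frac_rel R S" "((a', s'), (b', t')) \<in> frac_rel R S"
    then obtain u v where m: "a \<in> carrier R" "b \<in> carrier R" "a' \<in> carrier R" "b' \<in> carrier R"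
      "s \<in> S" "t \<in> S" "s' \<in> S" "t' \<in> S" "u \<in> S" "v \<in> S"
      and u: "u \<otimes> (a \<otimes> t) = u \<otimes> (b \<otimes> s)" and v: "v \<otimes> (a' \<otimes> t') = v \<otimes> (b' \<otimes> s')"
      by (auto simp: frac_rel_iff)
    note c = m(1-4) m(5-10)[THEN S_carrier]
    have "(u \<otimes> v) \<otimes> ((a \<otimes> s' \<oplus> a' \<otimes> s) \<otimes> (t \<otimes> t'))
      = (u \<otimes> (a \<otimes> t)) \<otimes> (v \<otimes> (s' \<otimes> t')) \<oplus> (v \<otimes> (a' \<otimes> t')) \<otimes> (u \<otimes> (s \<otimes> t))"
      using c by (simp add: m_ac l_distr r_distr)
    also have "\<dots> = (u \<otimes> v) \<otimes> ((b \<otimes> t' \<oplus> b' \<otimes> t) \<otimes> (s \<otimes> s'))"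
      unfolding u v using c by (simp add: m_ac l_distr r_distr)
    finally show "frac_class R S (a \<otimes> s' \<oplus> a' \<otimes> s) (s \<otimes> s')
        = frac_class R S (b \<otimes> t' \<oplus> b' \<otimes> t) (t \<otimes> t')"
      using m mult_mem S_carrier by (subst frac_class_eq_iff) auto
  qed
  from UN_equiv_class2[OF equiv_frac_rel equiv_frac_rel this] 
  have "(\<Union>x\<in>frac_rel R S `` {(r, s)}. \<Union>y\<in>frac_rel R S `` {(r', s')}. ?f x y) = ?f (r, s) (r', s')"
    using assms by blast
  then show ?thesis
    by (simp add: localization_def frac_class_def case_prod_beta')
qed

end

end

(* Everything reduces to fractions over multiplicatively closed sets: if S is contained in T,
   the element u of S that witnesses r/s = r'/s' over S also witnesses it over T, so r/s \<mapsto> r/s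
   is well defined. It visibly respects the fraction formulas for sum and product and is
   compatible with inclusions. An inclusion of primes reverses to an inclusion of complements. *)
theory Submission
  imports Defs
begin

context mult_closed_subset
begin

text \<open>The witness is u = 1. With zero divisors around this criterion is only sufficient, but
  it covers fractions that differ by cancelling a common factor, which is all the ring axioms
  require.\<close>

lemma frac_class_eqI:
  assumes "r \<in> carrier R" "s \<in> S" "r' \<in> carrier R" "s' \<in> S" "r \<otimes> s' = r' \<otimes> s"
  shows "frac_class R S r s = frac_class R S r' s'"
  using assms one_mem by (auto simp: frac_class_eq_iff)

lemma carrier_localization:
  "carrier (localization R S) = {frac_class R S r s |r s. r \<in> carrier R \<and> s \<in> S}"
  by (auto simp: localization_def frac_class_def quotient_def)

lemma frac_class_closed:
  "r \<in> carrier R \<Longrightarrow> s \<in> S \<Longrightarrow> frac_class R S r s \<in> carrier (localization R S)"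
  unfolding carrier_localization by blast

lemma localization_one: "\<one>\<^bsub>localization R S\<^esub> = frac_class R S \<one> \<one>"
  by (simp add: localization_def)

lemma localization_zero: "\<zero>\<^bsub>localization R S\<^esub> = frac_class R S \<zero> \<one>"
  by (simp add: localization_def)

lemmas localization_frac_simps =
  localization_one localization_zero localization_mult_frac localization_add_frac

text \<open>After choosing representatives, each law becomes a computation with numerators and
  denominators in R. Except for inverses, both sides have equal numerators and equal denominators,
  so no witness is involved.\<close>

lemma abelian_group_localization: "abelian_group (localization R S)"
proof (rule abelian_groupI)
  let ?L = "localization R S"
  note [simp] = localization_frac_simps S_carrier one_mem mult_mem
  show "\<zero>\<^bsub>?L\<^esub> \<in> carrier ?L"
    by (simp add: frac_class_closed)
  fix x assume "x \<in> carrier ?L"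
  then obtain a s where x: "x = frac_class R S a s" and a: "a \<in> carrier R" "s \<in> S"
    by (auto simp: carrier_localization)
  show "\<zero>\<^bsub>?L\<^esub> \<oplus>\<^bsub>?L\<^esub> x = x"
    using a by (simp add: x)
  \<comment> \<open>The sum evaluates to 0/(s s) rather than 0/1, hence the cross
    multiplication.\<close>
  have "frac_class R S (\<ominus> a) s \<oplus>\<^bsub>?L\<^esub> x = \<zero>\<^bsub>?L\<^esub>"
    using a by (simp add: x l_minus l_neg) (rule frac_class_eqI; simp)
  then show "\<exists>y\<in>carrier ?L. y \<oplus>\<^bsub>?L\<^esub> x = \<zero>\<^bsub>?L\<^esub>"
    using a frac_class_closed by blast
  fix y assume "y \<in> carrier ?L"
  then obtain b t where y: "y = frac_class R S b t" and b: "b \<in> carrier R" "t \<in> S"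
    by (auto simp: carrier_localization)
  show "x \<oplus>\<^bsub>?L\<^esub> y \<in> carrier ?L"
    using a b by (simp add: x y frac_class_closed)
  show "x \<oplus>\<^bsub>?L\<^esub> y = y \<oplus>\<^bsub>?L\<^esub> x"
    using a b by (simp add: x y a_comm m_comm)
  fix z assume "z \<in> carrier ?L"
  then obtain c w where z: "z = frac_class R S c w" and c: "c \<in> carrier R" "w \<in> S"
    by (auto simp: carrier_localization)
  \<comment> \<open>Both sides expand to the numerator a t w + b s w + c s t over s t w.\<close>
  show "x \<oplus>\<^bsub>?L\<^esub> y \<oplus>\<^bsub>?L\<^esub> z = x \<oplus>\<^bsub>?L\<^esub> (y \<oplus>\<^bsub>?L\<^esub> z)"
    using a b c by (simp add: x y z l_distr r_distr m_ac a_ac)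
qed

lemma comm_monoid_localization: "comm_monoid (localization R S)"
proof (rule comm_monoidI)
  let ?L = "localization R S"
  note [simp] = localization_frac_simps S_carrier one_mem mult_mem
  show "\<one>\<^bsub>?L\<^esub> \<in> carrier ?L"
    by (simp add: frac_class_closed)
  fix x assume "x \<in> carrier ?L"
  then obtain a s where x: "x = frac_class R S a s" and a: "a \<in> carrier R" "s \<in> S"
    by (auto simp: carrier_localization)
  show "\<one>\<^bsub>?L\<^esub> \<otimes>\<^bsub>?L\<^esub> x = x"
    using a by (simp add: x)
  fix y assume "y \<in> carrier ?L"
  then obtain b t where y: "y = frac_class R S b t" and b: "b \<in> carrier R" "t \<in> S"
    by (auto simp: carrier_localization)
  show "x \<otimes>\<^bsub>?L\<^esub> y \<in> carrier ?L"
    using a b by (simp add: x y frac_class_closed)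
  show "x \<otimes>\<^bsub>?L\<^esub> y = y \<otimes>\<^bsub>?L\<^esub> x"
    using a b by (simp add: x y m_comm)
  fix z assume "z \<in> carrier ?L"
  then obtain c w where z: "z = frac_class R S c w" and c: "c \<in> carrier R" "w \<in> S"
    by (auto simp: carrier_localization)
  show "x \<otimes>\<^bsub>?L\<^esub> y \<otimes>\<^bsub>?L\<^esub> z = x \<otimes>\<^bsub>?L\<^esub> (y \<otimes>\<^bsub>?L\<^esub> z)"
    using a b c by (simp add: x y z m_assoc)
qed

lemma cring_localization: "cring (localization R S)"
proof (rule cringI[OF abelian_group_localization comm_monoid_localization])
  let ?L = "localization R S"
  note [simp] = localization_frac_simps S_carrier mult_mem
  fix x y z assume "x \<in> carrier ?L" "y \<in> carrier ?L" "z \<in> carrier ?L"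
  then obtain a s b t c w where xyz: "x = frac_class R S a s" "y = frac_class R S b t"
      "z = frac_class R S c w"
    and m: "a \<in> carrier R" "s \<in> S" "b \<in> carrier R" "t \<in> S" "c \<in> carrier R" "w \<in> S"
    by (auto simp: carrier_localization)
  \<comment> \<open>The right side has denominator (s w)(t w), against (s t) w on the left:
    numerator and denominator carry an extra factor w, which cross multiplication absorbs.\<close>
  show "(x \<oplus>\<^bsub>?L\<^esub> y) \<otimes>\<^bsub>?L\<^esub> z = x \<otimes>\<^bsub>?L\<^esub> z \<oplus>\<^bsub>?L\<^esub> y \<otimes>\<^bsub>?L\<^esub> z"
    using m by (simp add: xyz) (rule frac_class_eqI; simp add: l_distr r_distr m_ac)
qed

lemma frac_class_mono:
  assumes "mult_closed_subset R T" "S \<subseteq> T"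
    and "r \<in> carrier R" "s \<in> S" "r' \<in> carrier R" "s' \<in> S"
    and "frac_class R S r s = frac_class R S r' s'"
  shows "frac_class R T r s = frac_class R T r' s'"
  using assms frac_class_eq_iff mult_closed_subset.frac_class_eq_iff[OF assms(1)]
  by (meson subsetD)

text \<open>By \<open>frac_class_mono\<close> the family is constant on each class of
  \<open>frac_rel R S\<close>, so the union over representatives collapses to one member. This
  justifies encoding the canonical map as a union.\<close>

lemma UN_frac_class:
  assumes T: "mult_closed_subset R T" "S \<subseteq> T" and r: "r \<in> carrier R" "s \<in> S"
  shows "(\<Union>(a, b)\<in>frac_class R S r s. frac_class R T a b) = frac_class R T r s"
proof -
  have "(\<lambda>(a, b). frac_class R T a b) respects frac_rel R S"
  proof (rule congruentI, clarify)
    fix a b c d assume ab: "((a, b), (c, d)) \<in> frac_rel R S"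
    then have "frac_class R S a b = frac_class R S c d"
      unfolding frac_class_def by (rule equiv_class_eq[OF equiv_frac_rel])
    with ab show "frac_class R T a b = frac_class R T c d"
      by (intro frac_class_mono[OF T]) (auto simp: frac_rel_iff)
  qed
  from UN_equiv_class[OF equiv_frac_rel this] r show ?thesis
    by (force simp: frac_class_def)
qed

end

lemma (in cring) mult_closed_subset_prime_compl:
  assumes "primeideal \<pp> R"
  shows "mult_closed_subset R (carrier R - \<pp>)"
proof -
  interpret primeideal \<pp> R by fact
  show ?thesis
    \<comment> \<open>Properness of the ideal keeps 1 in the complement; primality makes the
      complement closed under products.\<close>
    using one_imp_carrier I_notcarr I_prime by unfold_locales auto
qed

text \<open>This is \<open>UN_frac_class\<close> for the complements of \<pp> and \<qq>. Everything
  below computes with this formula and never returns to the union.\<close>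

lemma (in cring) localization_map_frac:
  assumes "primeideal \<pp> R" "primeideal \<qq> R" "\<qq> \<subseteq> \<pp>" "r \<in> carrier R" "s \<in> carrier R - \<pp>"
  shows "localization_map R \<qq> (frac_at R \<pp> r s) = frac_at R \<qq> r s"
  using assms
  by (simp add: localization_map_def frac_at_def Diff_mono
      mult_closed_subset.UN_frac_class mult_closed_subset_prime_compl)

lemma (in cring) carrier_localization_at:
  assumes "primeideal \<pp> R"
  shows "carrier (localization_at R \<pp>)
    = {frac_at R \<pp> r s |r s. r \<in> carrier R \<and> s \<in> carrier R - \<pp>}"
  unfolding localization_at_def frac_at_def
  by (rule mult_closed_subset.carrier_localization[OF mult_closed_subset_prime_compl[OF assms]])

lemma (in cring) localization_map_hom:
  assumes \<pp>: "primeideal \<pp> R" and \<qq>: "primeideal \<qq> R" and sub: "\<qq> \<subseteq> \<pp>"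
  shows "localization_map R \<qq> \<in> ring_hom (localization_at R \<pp>) (localization_at R \<qq>)"
proof -
  interpret P: mult_closed_subset R "carrier R - \<pp>"
    by (rule mult_closed_subset_prime_compl[OF \<pp>])
  interpret Q: mult_closed_subset R "carrier R - \<qq>"
    by (rule mult_closed_subset_prime_compl[OF \<qq>])
  note map = localization_map_frac[OF \<pp> \<qq> sub, unfolded frac_at_def]
  note car = P.carrier_localization Q.carrier_localization
  \<comment> \<open>The fraction formulas over \<qq> apply only to denominators admissible
    there.\<close>
  have PQ: "s \<in> carrier R - \<qq>" if "s \<in> carrier R - \<pp>" for s
    using that sub by blast
  show ?thesis
    unfolding localization_at_def
  proof (rule ring_hom_memI)
    fix x assume "x \<in> carrier (localization R (carrier R - \<pp>))"
    then obtain a s where x: "x = frac_class R (carrier R - \<pp>) a s"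
      and a: "a \<in> carrier R" "s \<in> carrier R - \<pp>"
      unfolding car by blast
    show "localization_map R \<qq> x \<in> carrier (localization R (carrier R - \<qq>))"
      unfolding x map[OF a] using a PQ by (intro Q.frac_class_closed)
    fix y assume "y \<in> carrier (localization R (carrier R - \<pp>))"
    then obtain b t where y: "y = frac_class R (carrier R - \<pp>) b t"
      and b: "b \<in> carrier R" "t \<in> carrier R - \<pp>"
      unfolding car by blast
    \<comment> \<open>The product s t is the denominator of both x y and x + y, so
      \<open>map\<close> applies to each of them.\<close>
    note st = P.mult_mem[OF a(2) b(2)]
    have c: "a \<otimes> b \<in> carrier R" "a \<otimes> t \<oplus> b \<otimes> s \<in> carrier R"
      using a b by auto
    show "localization_map R \<qq> (x \<otimes>\<^bsub>localization R (carrier R - \<pp>)\<^esub> y)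
      = localization_map R \<qq> x \<otimes>\<^bsub>localization R (carrier R - \<qq>)\<^esub> localization_map R \<qq> y"
      unfolding x y P.localization_mult_frac[OF a b] map[OF c(1) st] map[OF a] map[OF b]
        Q.localization_mult_frac[OF a(1) PQ[OF a(2)] b(1) PQ[OF b(2)]] ..
    show "localization_map R \<qq> (x \<oplus>\<^bsub>localization R (carrier R - \<pp>)\<^esub> y)
      = localization_map R \<qq> x \<oplus>\<^bsub>localization R (carrier R - \<qq>)\<^esub> localization_map R \<qq> y"
      unfolding x y P.localization_add_frac[OF a b] map[OF c(2) st] map[OF a] map[OF b]
        Q.localization_add_frac[OF a(1) PQ[OF a(2)] b(1) PQ[OF b(2)]] ..
  next
    show "localization_map R \<qq> \<one>\<^bsub>localization R (carrier R - \<pp>)\<^esub>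
      = \<one>\<^bsub>localization R (carrier R - \<qq>)\<^esub>"
      unfolding P.localization_one Q.localization_one by (rule map[OF one_closed P.one_mem])
  qed
qed

text \<open>The conjuncts before the sheaf condition spell out "well defined": denominators stay
  admissible, equal fractions have equal images, and the union in \<open>localization_map\<close>
  really is r/s \<mapsto> r/s.\<close>

theorem proposition3:
  fixes R :: "('a, 'm) ring_scheme"
    and V :: "'v set" and K :: "'v set set"
    and \<P> :: "'v set \<Rightarrow> 'a set"
  assumes "cring R"
    and "simplicial_complex V K"
    and "\<P> \<in> K \<rightarrow> Spec R"
    and "\<And>\<sigma> \<tau>. \<sigma> \<in> K \<Longrightarrow> \<tau> \<in> K \<Longrightarrow> \<sigma> \<subseteq> \<tau> \<Longrightarrow> \<P> \<tau> \<subseteq> \<P> \<sigma>"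
  shows "(\<forall>\<sigma>\<in>K. \<forall>\<tau>\<in>K. \<sigma> \<subseteq> \<tau> \<longrightarrow>
           (\<forall>r\<in>carrier R. \<forall>s\<in>carrier R - \<P> \<sigma>.
              s \<in> carrier R - \<P> \<tau> \<and>
              (\<forall>r'\<in>carrier R. \<forall>s'\<in>carrier R - \<P> \<sigma>.
                 frac_at R (\<P> \<sigma>) r s = frac_at R (\<P> \<sigma>) r' s' \<longrightarrow>
                 frac_at R (\<P> \<tau>) r s = frac_at R (\<P> \<tau>) r' s') \<and>
              localization_map R (\<P> \<tau>) (frac_at R (\<P> \<sigma>) r s) = frac_at R (\<P> \<tau>) r s)) \<and>
         cellular_sheaf_of_rings V K
           (\<lambda>\<sigma>. localization_at R (\<P> \<sigma>))
           (\<lambda>\<sigma> \<tau>. localization_map R (\<P> \<tau>))"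
proof -
  interpret cring R by fact
  have prime: "primeideal (\<P> \<sigma>) R" if "\<sigma> \<in> K" for \<sigma>
    using assms(3) that by (auto simp: Spec_def)
  have map: "localization_map R (\<P> \<tau>) (frac_at R (\<P> \<sigma>) r s) = frac_at R (\<P> \<tau>) r s"
    if "\<sigma> \<in> K" "\<tau> \<in> K" "\<sigma> \<subseteq> \<tau>" "r \<in> carrier R" "s \<in> carrier R - \<P> \<sigma>" for \<sigma> \<tau> r s
    using that by (intro localization_map_frac prime assms(4))
  note car = carrier_localization_at[OF prime]
  have "cellular_sheaf_of_rings V K (\<lambda>\<sigma>. localization_at R (\<P> \<sigma>))
      (\<lambda>\<sigma> \<tau>. localization_map R (\<P> \<tau>))"
  proof (rule cellular_sheaf_of_rings.intro[OF assms(2)], rule cellular_sheaf_of_rings_axioms.intro)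
    fix \<sigma> assume \<sigma>: "\<sigma> \<in> K"
    show "cring (localization_at R (\<P> \<sigma>))"
      unfolding localization_at_def
      by (intro mult_closed_subset.cring_localization mult_closed_subset_prime_compl prime \<sigma>)
    \<comment> \<open>The identity law is the formula for the canonical map with equal source and
      target primes.\<close>
    show "localization_map R (\<P> \<sigma>) x = x" if "x \<in> carrier (localization_at R (\<P> \<sigma>))" for x
      using that map[OF \<sigma> \<sigma> subset_refl] unfolding car[OF \<sigma>] by auto
    fix \<tau> assume \<tau>: "\<tau> \<in> K" "\<sigma> \<subseteq> \<tau>"
    show "localization_map R (\<P> \<tau>) \<in> ring_hom (localization_at R (\<P> \<sigma>)) (localization_at R (\<P> \<tau>))"
      using \<sigma> \<tau> by (intro localization_map_hom prime assms(4))
    fix \<rho> x assume \<rho>: "\<rho> \<in> K" "\<tau> \<subseteq> \<rho>" and "x \<in> carrier (localization_at R (\<P> \<sigma>))"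
    then obtain r s where x: "x = frac_at R (\<P> \<sigma>) r s"
      and r: "r \<in> carrier R" "s \<in> carrier R - \<P> \<sigma>"
      unfolding car[OF \<sigma>] by blast
    \<comment> \<open>The second restriction acts on r/s over \<P> \<tau>, so s must be a
      denominator there; then both composites evaluate to r/s over \<P> \<rho>.\<close>
    have s: "s \<in> carrier R - \<P> \<tau>"
      using r assms(4)[OF \<sigma> \<tau>] by blast
    show "localization_map R (\<P> \<rho>) (localization_map R (\<P> \<tau>) x) = localization_map R (\<P> \<rho>) x"
      unfolding x map[OF \<sigma> \<tau> r] map[OF \<tau>(1) \<rho> r(1) s]
        map[OF \<sigma> \<rho>(1) subset_trans[OF \<tau>(2) \<rho>(2)] r] ..
  qed
  moreover have "s \<in> carrier R - \<P> \<tau>"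
    if "\<sigma> \<in> K" "\<tau> \<in> K" "\<sigma> \<subseteq> \<tau>" "s \<in> carrier R - \<P> \<sigma>" for \<sigma> \<tau> s
    using that assms(4) by blast
  \<comment> \<open>Both fractions over \<P> \<tau> are values of the same map at equal arguments,
    so independence of representatives follows from \<open>map\<close>.\<close>
  moreover have "frac_at R (\<P> \<tau>) r s = frac_at R (\<P> \<tau>) r' s'"
    if "\<sigma> \<in> K" "\<tau> \<in> K" "\<sigma> \<subseteq> \<tau>" "r \<in> carrier R" "s \<in> carrier R - \<P> \<sigma>"
      "r' \<in> carrier R" "s' \<in> carrier R - \<P> \<sigma>" "frac_at R (\<P> \<sigma>) r s = frac_at R (\<P> \<sigma>) r' s'"
    for \<sigma> \<tau> r s r' s'
    using map[of \<sigma> \<tau> r s] map[of \<sigma> \<tau> r' s'] that by simp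
  ultimately show ?thesis
    using map by (intro conjI ballI impI)
qed

end
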